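(* Let $\mathcal{C}$ be either the category of Banach Abelian groups or the category of non-Archimedean Banach Abelian groups, let $R$ be a commutative monoid object of $\mathcal{C}$, and let $X$ be a topological space. If $R$ is isolated at $0$, then the map $$G \colon \mathcal{M}(\mathrm{C}_{\mathrm{fin}}(X,R)) \to \zeta(X) \times \mathcal{M}(R), \qquad x \mapsto (\mathcal{F}_{X,x},\, x|_R)$$ is a homeomorphism, where $\mathcal{F}_{X,x} = \{U \in \mathrm{CO}(X) \mid x(1_{X,R,U}) \neq 0\}$ and $x|_R$ is the composite of $x$ with the canonical ring homomorphism $R \to \mathrm{C}_{\mathrm{fin}}(X,R)$ (constant functions).
   Context: A complete norm on an Abelian group $M$ is a map $\|\cdot\|_M \colon M \to [0,\infty)$ such that $(m_0,m_1) \mapsto \|m_0-m_1\|_M$ is a complete metric. A Banach Abelian group is an Abelian group with a complete norm; it is non-Archimedean if the metric is an ultrametric. Morphisms are bounded group homomorphisms. Both categories are symmetric monoidal for the (respective) completed projective tensor product, so a commutative monoid object $R$ is a commutative unital ring with a complete (resp. complete ultrametric) norm and $\|ab\|\le C\|a\|\|b\|$ for some constant $C$. $R$ is isolated at $0$ if $\{0\}\subset R$ is open for the norm topology. $\mathrm{C}_{\mathrm{fin}}(X,R)$ is the ring of continuous maps $X\to R$ with finite image, with the supremum norm (a commutative Banach $R$-algebra when $R$ is isolated at $0$). $\mathrm{CO}(X)$ is the set of clopen subsets of $X$, and $1_{X,R,U}$ is the $R$-valued characteristic function of $U\in \mathrm{CO}(X)$. $\zeta(X)$ is the Banaschewski compactification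 of $X$, realised as the space of ultrafilters of the Boolean algebra $\mathrm{CO}(X)$ (Stone space), with basis of open sets $\{\mathcal{F}\mid U\in\mathcal{F}\}$, $U\in \mathrm{CO}(X)$; under the hypothesis $\mathcal{F}_{X,x}$ is such an ultrafilter. For a Banach ring $A$, $\mathcal{M}(A)$ is the Berkovich spectrum: the set of maps $x\colon A\to[0,\infty)$ with $x(0)=0$, $x(1)=1$, $x(ab)=x(a)x(b)$, $x(a+b)\le x(a)+x(b)$, and $x(a)\le C\|a\|_A$ for some $C$, with the topology of pointwise convergence. *)

theory Defs
  imports "HOL-Analysis.Analysis" "HOL-Algebra.Ring"
begin

record 'a normed_ring = "'a ring" + rnorm :: "'a \<Rightarrow> real"

text \<open>The locale \<^locale>\<open>Metric_space\<close> constrains the distance on the whole type, so the distance is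
  cut off outside the carrier.\<close>

definition norm_dist :: "('a, 'm) normed_ring_scheme \<Rightarrow> 'a \<Rightarrow> 'a \<Rightarrow> real" where
  "norm_dist M a b =
     (if a \<in> carrier M \<and> b \<in> carrier M then rnorm M (a \<ominus>\<^bsub>M\<^esub> b) else 0)"

definition norm_topology :: "('a, 'm) normed_ring_scheme \<Rightarrow> 'a topology" where
  "norm_topology M = Metric_space.mtopology (carrier M) (norm_dist M)"

definition complete_norm :: "('a, 'm) normed_ring_scheme \<Rightarrow> bool" where
  "complete_norm M \<longleftrightarrow>
     (\<forall>a\<in>carrier M. 0 \<le> rnorm M a) \<and>
     Metric_space (carrier M) (norm_dist M) \<and>
     Metric_space.mcomplete (carrier M) (norm_dist M)"

definition banach_abelian_group :: "('a, 'm) normed_ring_scheme \<Rightarrow> bool" where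
  "banach_abelian_group M \<longleftrightarrow> abelian_group M \<and> complete_norm M"

definition nonarch_banach_abelian_group :: "('a, 'm) normed_ring_scheme \<Rightarrow> bool" where
  "nonarch_banach_abelian_group M \<longleftrightarrow>
     banach_abelian_group M \<and>
     (\<forall>a\<in>carrier M. \<forall>b\<in>carrier M. \<forall>c\<in>carrier M.
        norm_dist M a c \<le> max (norm_dist M a b) (norm_dist M b c))"

definition bounded_mult :: "('a, 'm) normed_ring_scheme \<Rightarrow> bool" where
  "bounded_mult R \<longleftrightarrow>
     (\<exists>C. \<forall>a\<in>carrier R. \<forall>b\<in>carrier R. rnorm R (a \<otimes>\<^bsub>R\<^esub> b) \<le> C * rnorm R a * rnorm R b)"

text \<open>Commutative monoid objects, for the completed projective tensor product, of the categories of
  Banach Abelian groups and of non-Archimedean Banach Abelian groups. The zero ring is allowed,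
  as \<^const>\<open>cring\<close> does not require \<open>\<one> \<noteq> \<zero>\<close>.\<close>

definition banach_cring :: "('a, 'm) normed_ring_scheme \<Rightarrow> bool" where
  "banach_cring R \<longleftrightarrow> cring R \<and> banach_abelian_group R \<and> bounded_mult R"

definition nonarch_banach_cring :: "('a, 'm) normed_ring_scheme \<Rightarrow> bool" where
  "nonarch_banach_cring R \<longleftrightarrow> cring R \<and> nonarch_banach_abelian_group R \<and> bounded_mult R"

definition isolated_at_zero :: "('a, 'm) normed_ring_scheme \<Rightarrow> bool" where
  "isolated_at_zero R \<longleftrightarrow> openin (norm_topology R) {\<zero>\<^bsub>R\<^esub>}"

text \<open>Maps defined on \<^term>\<open>topspace X\<close>, or on the carrier of a ring, are represented by
  extensional functions.\<close>

definition const_map :: "'x topology \<Rightarrow> 'a \<Rightarrow> 'x \<Rightarrow> 'a" where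
  "const_map X a = (\<lambda>p\<in>topspace X. a)"

definition C_fin :: "'x topology \<Rightarrow> ('a, 'm) normed_ring_scheme \<Rightarrow> ('x \<Rightarrow> 'a) normed_ring" where
  "C_fin X R =
     \<lparr>carrier = {f \<in> extensional (topspace X).
                   continuous_map X (norm_topology R) f \<and> finite (f ` topspace X)},
      monoid.mult = (\<lambda>f g. \<lambda>p\<in>topspace X. f p \<otimes>\<^bsub>R\<^esub> g p),
      one = const_map X \<one>\<^bsub>R\<^esub>,
      zero = const_map X \<zero>\<^bsub>R\<^esub>,
      add = (\<lambda>f g. \<lambda>p\<in>topspace X. f p \<oplus>\<^bsub>R\<^esub> g p),
      rnorm = (\<lambda>f. if topspace X = {} then 0 else (SUP p\<in>topspace X. rnorm R (f p)))\<rparr>"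

definition clopens :: "'x topology \<Rightarrow> 'x set set" where
  "clopens X = {U. openin X U \<and> closedin X U}"

definition char_fun :: "'x topology \<Rightarrow> ('a, 'm) normed_ring_scheme \<Rightarrow> 'x set \<Rightarrow> 'x \<Rightarrow> 'a" where
  "char_fun X R U = (\<lambda>p\<in>topspace X. if p \<in> U then \<one>\<^bsub>R\<^esub> else \<zero>\<^bsub>R\<^esub>)"

definition proper_clopen_filter :: "'x topology \<Rightarrow> 'x set set \<Rightarrow> bool" where
  "proper_clopen_filter X F \<longleftrightarrow>
     F \<subseteq> clopens X \<and> topspace X \<in> F \<and> {} \<notin> F \<and>
     (\<forall>U\<in>F. \<forall>V\<in>F. U \<inter> V \<in> F) \<and>
     (\<forall>U\<in>F. \<forall>V\<in>clopens X. U \<subseteq> V \<longrightarrow> V \<in> F)"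

definition clopen_ultrafilters :: "'x topology \<Rightarrow> 'x set set set" where
  "clopen_ultrafilters X =
     {F. proper_clopen_filter X F \<and> (\<forall>F'. proper_clopen_filter X F' \<and> F \<subseteq> F' \<longrightarrow> F' = F)}"

text \<open>The generating family below contains the whole space (take \<open>U = topspace X\<close>) and is closed
  under binary intersections, so it is a basis and not merely a subbasis.\<close>

definition banaschewski :: "'x topology \<Rightarrow> 'x set set topology" where
  "banaschewski X =
     topology_generated_by ((\<lambda>U. {F \<in> clopen_ultrafilters X. U \<in> F}) ` clopens X)"

definition berkovich_points :: "('a, 'm) normed_ring_scheme \<Rightarrow> ('a \<Rightarrow> real) set" where
  "berkovich_points A =
     {x \<in> extensional (carrier A).
        (\<forall>a\<in>carrier A. 0 \<le> x a) \<and>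
        x \<zero>\<^bsub>A\<^esub> = 0 \<and> x \<one>\<^bsub>A\<^esub> = 1 \<and>
        (\<forall>a\<in>carrier A. \<forall>b\<in>carrier A. x (a \<otimes>\<^bsub>A\<^esub> b) = x a * x b) \<and>
        (\<forall>a\<in>carrier A. \<forall>b\<in>carrier A. x (a \<oplus>\<^bsub>A\<^esub> b) \<le> x a + x b) \<and>
        (\<exists>C. \<forall>a\<in>carrier A. x a \<le> C * rnorm A a)}"

definition berkovich_spectrum :: "('a, 'm) normed_ring_scheme \<Rightarrow> ('a \<Rightarrow> real) topology" where
  "berkovich_spectrum A =
     subtopology (product_topology (\<lambda>_. euclideanreal) (carrier A)) (berkovich_points A)"

definition point_filter ::
  "'x topology \<Rightarrow> ('a, 'm) normed_ring_scheme \<Rightarrow> (('x \<Rightarrow> 'a) \<Rightarrow> real) \<Rightarrow> 'x set set" where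
  "point_filter X R x = {U \<in> clopens X. x (char_fun X R U) \<noteq> 0}"

definition point_restrict ::
  "'x topology \<Rightarrow> ('a, 'm) normed_ring_scheme \<Rightarrow> (('x \<Rightarrow> 'a) \<Rightarrow> real) \<Rightarrow> 'a \<Rightarrow> real" where
  "point_restrict X R x = (\<lambda>a\<in>carrier R. x (const_map X a))"

end

theory Submission
  imports Defs
begin

text \<open>Isolation at \<open>0\<close> makes the topology of \<open>R\<close> discrete, so an element \<open>f\<close> of the ring
  \<open>C_fin X R\<close> is a locally constant function with finitely many values, and a clopen ultrafilter
  contains exactly one fibre of \<open>f\<close>. If that fibre \<open>U\<close> has value \<open>v\<close>, then \<open>f * 1_U = v * 1_U\<close>.
  Since \<open>1_U\<close> is idempotent, a multiplicative seminorm \<open>x\<close> takes the value \<open>1\<close> at it as soon as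
  \<open>U\<close> belongs to the ultrafilter of \<open>x\<close>, whence \<open>x f = x v\<close>. The inverse map therefore sends
  \<open>(F, y)\<close> to \<open>f \<mapsto> y (v F f)\<close>, where \<open>v F f\<close> is the value of \<open>f\<close> along \<open>F\<close>, and it is continuous
  because \<open>v F f\<close> is locally constant in \<open>F\<close>.\<close>

section \<open>Clopen ultrafilters\<close>

lemma clopens_diff: "U \<in> clopens X \<Longrightarrow> topspace X - U \<in> clopens X"
  by (simp add: clopens_def openin_diff closedin_diff)

lemma clopens_Int: "U \<in> clopens X \<Longrightarrow> V \<in> clopens X \<Longrightarrow> U \<inter> V \<in> clopens X"
  by (simp add: clopens_def openin_Int closedin_Int)

lemma clopens_topspace: "topspace X \<in> clopens X"
  by (simp add: clopens_def)

lemma clopens_subset: "U \<in> clopens X \<Longrightarrow> U \<subseteq> topspace X"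
  by (simp add: clopens_def openin_subset)

text \<open>If neither set belonged to \<open>F\<close>, then \<open>F\<close> and \<open>U\<close>
  together would generate a proper filter, and maximality would force \<open>U\<close> into
  \<open>F\<close> after all.\<close>

lemma clopen_ultrafilter_dichotomy:
  assumes F: "F \<in> clopen_ultrafilters X" and U: "U \<in> clopens X"
  shows "U \<in> F \<or> topspace X - U \<in> F"
proof (rule ccontr)
  assume neg: "\<not> (U \<in> F \<or> topspace X - U \<in> F)"
  have pF: "proper_clopen_filter X F"
    and maximal: "\<And>F'. proper_clopen_filter X F' \<Longrightarrow> F \<subseteq> F' \<Longrightarrow> F' = F"
    using F by (auto simp: clopen_ultrafilters_def)
  note pF' = pF[unfolded proper_clopen_filter_def]
  \<comment> \<open>The filter generated by \<open>F\<close> and \<open>U\<close>. It could only be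
    improper if some \<open>W\<close> in \<open>F\<close> missed \<open>U\<close>, and then the
    complement of \<open>U\<close>, being larger than \<open>W\<close>, would lie in
    \<open>F\<close>.\<close>
  define F' where "F' = {V \<in> clopens X. \<exists>W\<in>F. W \<inter> U \<subseteq> V}"
  have "proper_clopen_filter X F'"
    unfolding proper_clopen_filter_def
  proof (intro conjI ballI impI)
    show "F' \<subseteq> clopens X" by (auto simp: F'_def)
    show "topspace X \<in> F'"
      using pF' clopens_topspace[of X] by (auto simp: F'_def)
    show "{} \<notin> F'"
    proof
      assume "{} \<in> F'"
      then obtain W where W: "W \<in> F" "W \<inter> U = {}" by (auto simp: F'_def)
      then have "W \<subseteq> topspace X - U" using pF' clopens_subset by blast
      then have "topspace X - U \<in> F" using pF' W(1) clopens_diff[OF U] by blast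
      then show False using neg by blast
    qed
    show "V \<inter> V' \<in> F'" if V: "V \<in> F'" and V': "V' \<in> F'" for V V'
    proof -
      obtain W W' where "W \<in> F" "W \<inter> U \<subseteq> V" "W' \<in> F" "W' \<inter> U \<subseteq> V'"
        using V V' by (auto simp: F'_def)
      then have "W \<inter> W' \<in> F" "(W \<inter> W') \<inter> U \<subseteq> V \<inter> V'" using pF' by auto
      then show ?thesis using V V' clopens_Int by (auto simp: F'_def)
    qed
    show "V' \<in> F'" if "V \<in> F'" "V' \<in> clopens X" "V \<subseteq> V'" for V V'
      using that by (auto simp: F'_def)
  qed
  moreover have "F \<subseteq> F'" using pF' by (auto simp: F'_def)
  ultimately have "F' = F" by (rule maximal)
  moreover have "U \<in> F'" using pF' U by (auto simp: F'_def)
  ultimately show False using neg by blast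
qed

text \<open>Converse of the dichotomy: a larger proper filter with a new member \<open>U\<close>
  would also contain the complement of \<open>U\<close>, hence the empty set. This gives a test for
  maximality that never mentions other filters.\<close>

lemma clopen_ultrafilterI:
  assumes pF: "proper_clopen_filter X F"
    and dich: "\<And>U. U \<in> clopens X \<Longrightarrow> U \<in> F \<or> topspace X - U \<in> F"
  shows "F \<in> clopen_ultrafilters X"
proof -
  have "F' = F" if pF': "proper_clopen_filter X F'" and "F \<subseteq> F'" for F'
  proof -
    have "U \<in> F" if "U \<in> F'" for U
    proof (rule ccontr)
      assume "U \<notin> F"
      then have "topspace X - U \<in> F'"
        using dich[of U] pF' \<open>F \<subseteq> F'\<close> \<open>U \<in> F'\<close> by (auto simp: proper_clopen_filter_def)
      then have "U \<inter> (topspace X - U) \<in> F'"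
        using pF' \<open>U \<in> F'\<close> unfolding proper_clopen_filter_def by blast
      moreover have "U \<inter> (topspace X - U) = {}" by blast
      ultimately show False using pF' by (metis proper_clopen_filter_def)
    qed
    then show ?thesis using \<open>F \<subseteq> F'\<close> by blast
  qed
  then show ?thesis using pF by (auto simp: clopen_ultrafilters_def)
qed

text \<open>Primeness of ultrafilters. Otherwise all complements would lie in \<open>F\<close>, and
  so would their finite intersection, which is empty because the \<open>U i\<close> cover the
  space.\<close>

lemma clopen_ultrafilter_finite_cover:
  assumes F: "F \<in> clopen_ultrafilters X" and fin: "finite I"
    and clopen: "\<And>i. i \<in> I \<Longrightarrow> U i \<in> clopens X"
    and cover: "topspace X \<subseteq> (\<Union>i\<in>I. U i)"
  obtains i where "i \<in> I" "U i \<in> F"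
proof -
  have pF: "proper_clopen_filter X F" using F by (simp add: clopen_ultrafilters_def)
  note pF' = pF[unfolded proper_clopen_filter_def]
  have "\<exists>i\<in>I. U i \<in> F"
  proof (rule ccontr)
    assume "\<not> (\<exists>i\<in>I. U i \<in> F)"
    then have compl: "topspace X - U i \<in> F" if "i \<in> I" for i
      using clopen_ultrafilter_dichotomy[OF F clopen[OF that]] that by blast
    have "topspace X - (\<Union>i\<in>J. U i) \<in> F" if "finite J" "J \<subseteq> I" for J
      using that
    proof (induction J)
      case empty
      then show ?case using pF' by simp
    next
      case (insert j J)
      then have "(topspace X - U j) \<inter> (topspace X - (\<Union>i\<in>J. U i)) \<in> F"
        using pF' compl by blast
      moreover have "(topspace X - U j) \<inter> (topspace X - (\<Union>i\<in>J. U i))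
          = topspace X - (\<Union>i\<in>insert j J. U i)"
        by blast
      ultimately show ?case by simp
    qed
    from this[OF fin subset_refl] have "topspace X - (\<Union>i\<in>I. U i) \<in> F" .
    moreover have "topspace X - (\<Union>i\<in>I. U i) = {}" using cover by blast
    ultimately show False using pF' by simp
  qed
  then show thesis using that by blast
qed

lemma topspace_banaschewski: "topspace (banaschewski X) = clopen_ultrafilters X"
proof -
  have "topspace X \<in> F" if "F \<in> clopen_ultrafilters X" for F
    using that by (simp add: clopen_ultrafilters_def proper_clopen_filter_def)
  then show ?thesis
    using clopens_topspace[of X] by (auto simp: banaschewski_def)
qed

lemma openin_banaschewski_basic:
  "U \<in> clopens X \<Longrightarrow> openin (banaschewski X) {F \<in> clopen_ultrafilters X. U \<in> F}"
  unfolding banaschewski_def by (rule topology_generated_by_Basis) blast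

lemma continuous_map_banaschewskiI:
  assumes "f \<in> topspace Y \<rightarrow> clopen_ultrafilters X"
    and "\<And>U. U \<in> clopens X \<Longrightarrow> openin Y {y \<in> topspace Y. U \<in> f y}"
  shows "continuous_map Y (banaschewski X) f"
  unfolding banaschewski_def
proof (rule continuous_on_generated_topo)
  show "openin Y (f -` B \<inter> topspace Y)"
    if "B \<in> (\<lambda>U. {F \<in> clopen_ultrafilters X. U \<in> F}) ` clopens X" for B
  proof -
    from that obtain U where U: "U \<in> clopens X" "B = {F \<in> clopen_ultrafilters X. U \<in> F}"
      by blast
    then have "f -` B \<inter> topspace Y = {y \<in> topspace Y. U \<in> f y}" using assms(1) by auto
    then show ?thesis using assms(2) U(1) by simp
  qed
  show "f ` topspace Y \<subseteq> \<Union> ((\<lambda>U. {F \<in> clopen_ultrafilters X. U \<in> F}) ` clopens X)"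
    using assms(1) topspace_banaschewski[of X] by (auto simp: banaschewski_def)
qed

section \<open>Multiplicative seminorms\<close>

lemma topspace_berkovich_spectrum: "topspace (berkovich_spectrum A) = berkovich_points A"
  by (auto simp: berkovich_spectrum_def berkovich_points_def PiE_def)

lemma continuous_map_berkovich_eval:
  assumes "a \<in> carrier A"
  shows "continuous_map (berkovich_spectrum A) euclideanreal (\<lambda>x. x a)"
  unfolding berkovich_spectrum_def
  by (rule continuous_map_from_subtopology) (rule continuous_map_product_projection[OF assms])

lemma continuous_map_berkovichI:
  assumes "f \<in> topspace Y \<rightarrow> berkovich_points A"
    and "\<And>a. a \<in> carrier A \<Longrightarrow> continuous_map Y euclideanreal (\<lambda>y. f y a)"
  shows "continuous_map Y (berkovich_spectrum A) f"
  using assms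
  by (auto simp: berkovich_spectrum_def continuous_map_in_subtopology continuous_map_componentwise
      berkovich_points_def)

lemma berkovich_pointsD:
  assumes "x \<in> berkovich_points A"
  shows "x \<in> extensional (carrier A)"
    and "\<And>a. a \<in> carrier A \<Longrightarrow> 0 \<le> x a"
    and "x \<zero>\<^bsub>A\<^esub> = 0" and "x \<one>\<^bsub>A\<^esub> = 1"
    and "\<And>a b. a \<in> carrier A \<Longrightarrow> b \<in> carrier A \<Longrightarrow> x (a \<otimes>\<^bsub>A\<^esub> b) = x a * x b"
    and "\<And>a b. a \<in> carrier A \<Longrightarrow> b \<in> carrier A \<Longrightarrow> x (a \<oplus>\<^bsub>A\<^esub> b) \<le> x a + x b"
    and "\<exists>C. \<forall>a\<in>carrier A. x a \<le> C * rnorm A a"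
  using assms by (auto simp: berkovich_points_def)

section \<open>Functions with finite image in a discrete ring\<close>

text \<open>The distance is translation invariant, so a ball around \<open>0\<close> that contains
  only \<open>0\<close> can be moved to any other point with the same radius.\<close>

lemma norm_topology_discrete:
  assumes "ring R" and "complete_norm R" and iso: "isolated_at_zero R"
  shows "norm_topology R = discrete_topology (carrier R)"
proof -
  interpret ring R by fact
  interpret M: Metric_space "carrier R" "norm_dist R"
    using assms(2) by (simp add: complete_norm_def)
  obtain r where r: "r > 0" "M.mball \<zero>\<^bsub>R\<^esub> r \<subseteq> {\<zero>\<^bsub>R\<^esub>}"
    using iso unfolding isolated_at_zero_def norm_topology_def M.openin_mtopology by blast
  have "openin M.mtopology {a}" if a: "a \<in> carrier R" for a
  proof -
    have "b = a" if b: "b \<in> M.mball a r" for b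
    proof -
      have bc: "b \<in> carrier R" using b by simp
      \<comment> \<open>The order of subtraction makes \<open>0 - (b - a)\<close> equal to
        \<open>a - b\<close>, so both distances are norms of the same element.\<close>
      have "norm_dist R \<zero>\<^bsub>R\<^esub> (b \<ominus>\<^bsub>R\<^esub> a) = norm_dist R a b"
        using a bc by (simp add: norm_dist_def a_minus_def minus_add a_comm)
      then have "b \<ominus>\<^bsub>R\<^esub> a \<in> M.mball \<zero>\<^bsub>R\<^esub> r" using b a bc by simp
      then have "b \<ominus>\<^bsub>R\<^esub> a = \<zero>\<^bsub>R\<^esub>" using r(2) by blast
      then show "b = a" using a bc minus_equality[of b "\<ominus>\<^bsub>R\<^esub> a"] by (simp add: a_minus_def)
    qed
    then have "M.mball a r = {a}" using a r(1) by auto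
    then show ?thesis using M.openin_mball by metis
  qed
  then show ?thesis
    unfolding norm_topology_def by (metis M.topspace_mtopology discrete_topology_unique)
qed

lemma C_fin_simps [simp]:
  "f \<otimes>\<^bsub>C_fin X R\<^esub> g = (\<lambda>p\<in>topspace X. f p \<otimes>\<^bsub>R\<^esub> g p)"
  "f \<oplus>\<^bsub>C_fin X R\<^esub> g = (\<lambda>p\<in>topspace X. f p \<oplus>\<^bsub>R\<^esub> g p)"
  "\<one>\<^bsub>C_fin X R\<^esub> = const_map X \<one>\<^bsub>R\<^esub>"
  "\<zero>\<^bsub>C_fin X R\<^esub> = const_map X \<zero>\<^bsub>R\<^esub>"
  by (simp_all add: C_fin_def)

definition fibre :: "'x topology \<Rightarrow> ('x \<Rightarrow> 'a) \<Rightarrow> 'a \<Rightarrow> 'x set" where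
  "fibre X f v = {p \<in> topspace X. f p = v}"

text \<open>The limit of \<open>f\<close> along \<open>F\<close> for the discrete topology. The
  description is meaningful when exactly one fibre of \<open>f\<close> lies in \<open>F\<close>,
  which holds for clopen ultrafilters and members of \<open>C_fin X R\<close>.\<close>

definition ultra_value :: "'x topology \<Rightarrow> 'x set set \<Rightarrow> ('x \<Rightarrow> 'a) \<Rightarrow> 'a" where
  "ultra_value X F f = (THE v. fibre X f v \<in> F)"

text \<open>The candidate for the inverse map; it is cut off outside the carrier because points of
  the spectrum are extensional.\<close>

definition glue ::
  "'x topology \<Rightarrow> ('a, 'm) normed_ring_scheme \<Rightarrow> 'x set set \<Rightarrow> ('a \<Rightarrow> real) \<Rightarrow> ('x \<Rightarrow> 'a) \<Rightarrow> real"
  where "glue X R F y = (\<lambda>f\<in>carrier (C_fin X R). y (ultra_value X F f))"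

text \<open>Uniqueness: fibres over different values are disjoint, and two members of a proper
  filter must meet.\<close>

lemma ultra_value_eqI:
  assumes "F \<in> clopen_ultrafilters X" and "fibre X f v \<in> F"
  shows "ultra_value X F f = v"
  unfolding ultra_value_def
proof (rule the_equality)
  show "w = v" if "fibre X f w \<in> F" for w
  proof -
    have "fibre X f w \<inter> fibre X f v \<in> F" and "{} \<notin> F"
      using assms that by (auto simp: clopen_ultrafilters_def proper_clopen_filter_def)
    then have "fibre X f w \<inter> fibre X f v \<noteq> {}" by metis
    then show ?thesis by (auto simp: fibre_def)
  qed
qed fact

text \<open>The common ground of the two categories once isolation at \<open>0\<close> has been
  used. Nonnegativity of the norm enters in the boundedness of glued seminorms.\<close>

locale discrete_normed_cring = cring R for R :: "('a, 'm) normed_ring_scheme" (structure) +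
  assumes norm_topology_eq: "norm_topology R = discrete_topology (carrier R)"
    and rnorm_nonneg: "a \<in> carrier R \<Longrightarrow> 0 \<le> rnorm R a"
begin

text \<open>Every preimage is a union of fibres, so continuity into a discrete space is openness of
  the fibres. Here \<open>v\<close> may range over the whole type, since fibres over values outside
  the carrier are empty.\<close>

lemma C_fin_carrier_iff:
  "f \<in> carrier (C_fin X R) \<longleftrightarrow>
     f \<in> extensional (topspace X) \<and> f \<in> topspace X \<rightarrow> carrier R \<and> finite (f ` topspace X) \<and>
     (\<forall>v. openin X (fibre X f v))"
proof -
  have "openin X {p \<in> topspace X. f p \<in> S}" if "\<forall>v. openin X (fibre X f v)" for S
  proof -
    have "{p \<in> topspace X. f p \<in> S} = (\<Union>v\<in>S. fibre X f v)" by (auto simp: fibre_def)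
    then show ?thesis using that by auto
  qed
  moreover have "openin X (fibre X f v)"
    if "f \<in> topspace X \<rightarrow> carrier R" "\<forall>S\<subseteq>carrier R. openin X {p \<in> topspace X. f p \<in> S}" for v
  proof (cases "v \<in> carrier R")
    case True
    then show ?thesis using that(2)[rule_format, of "{v}"] by (simp add: fibre_def)
  next
    case False
    then have "fibre X f v = {}" using that(1) by (auto simp: fibre_def)
    then show ?thesis by simp
  qed
  ultimately show ?thesis
    by (auto simp: C_fin_def continuous_map_def norm_topology_eq)
qed

lemma C_fin_carrierD:
  assumes "f \<in> carrier (C_fin X R)"
  shows "p \<in> topspace X \<Longrightarrow> f p \<in> carrier R"
    and "finite (f ` topspace X)"
    and "f \<in> extensional (topspace X)"
    and "fibre X f v \<in> clopens X"
proof -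
  show "p \<in> topspace X \<Longrightarrow> f p \<in> carrier R" "finite (f ` topspace X)" "f \<in> extensional (topspace X)"
    using assms by (auto simp: C_fin_carrier_iff)
  have op: "openin X (fibre X f w)" for w using assms by (simp add: C_fin_carrier_iff)
  \<comment> \<open>The complement of a fibre is the union of the other fibres, hence open.\<close>
  have "topspace X - fibre X f v = (\<Union>w\<in>- {v}. fibre X f w)" by (auto simp: fibre_def)
  then have "openin X (topspace X - fibre X f v)" using op by auto
  moreover have "fibre X f v \<subseteq> topspace X" by (auto simp: fibre_def)
  ultimately show "fibre X f v \<in> clopens X" using op by (simp add: clopens_def closedin_def)
qed

lemma C_fin_pointwise_closed:
  assumes f: "f \<in> carrier (C_fin X R)" and g: "g \<in> carrier (C_fin X R)"
    and h: "\<And>a b. a \<in> carrier R \<Longrightarrow> b \<in> carrier R \<Longrightarrow> h a b \<in> carrier R"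
  shows "(\<lambda>p\<in>topspace X. h (f p) (g p)) \<in> carrier (C_fin X R)"
  unfolding C_fin_carrier_iff
proof (intro conjI allI)
  let ?k = "\<lambda>p\<in>topspace X. h (f p) (g p)"
  show "?k \<in> extensional (topspace X)" by simp
  show "?k \<in> topspace X \<rightarrow> carrier R" using C_fin_carrierD(1)[OF f] C_fin_carrierD(1)[OF g] h by auto
  have "?k ` topspace X \<subseteq> (\<lambda>(a, b). h a b) ` (f ` topspace X \<times> g ` topspace X)" by auto
  then show "finite (?k ` topspace X)"
    using C_fin_carrierD(2)[OF f] C_fin_carrierD(2)[OF g] by (meson finite_SigmaI finite_imageI finite_subset)
  fix v
  \<comment> \<open>A fibre of the combined function splits according to the pair of values of
    \<open>f\<close> and \<open>g\<close>.\<close>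
  have "fibre X ?k v = (\<Union>(a, b)\<in>{(a, b). h a b = v}. fibre X f a \<inter> fibre X g b)"
    by (auto simp: fibre_def)
  moreover have "openin X (fibre X f a \<inter> fibre X g b)" for a b
    using C_fin_carrierD(4)[OF f] C_fin_carrierD(4)[OF g] by (simp add: clopens_def openin_Int)
  ultimately show "openin X (fibre X ?k v)" by auto
qed

lemma C_fin_mult_closed:
  "f \<in> carrier (C_fin X R) \<Longrightarrow> g \<in> carrier (C_fin X R) \<Longrightarrow>
     (\<lambda>p\<in>topspace X. f p \<otimes> g p) \<in> carrier (C_fin X R)"
  by (rule C_fin_pointwise_closed) auto

lemma C_fin_add_closed:
  "f \<in> carrier (C_fin X R) \<Longrightarrow> g \<in> carrier (C_fin X R) \<Longrightarrow>
     (\<lambda>p\<in>topspace X. f p \<oplus> g p) \<in> carrier (C_fin X R)"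
  by (rule C_fin_pointwise_closed) auto

lemma char_fun_closed:
  assumes "U \<in> clopens X"
  shows "char_fun X R U \<in> carrier (C_fin X R)"
  unfolding C_fin_carrier_iff
proof (intro conjI allI)
  show "char_fun X R U \<in> extensional (topspace X)" "char_fun X R U \<in> topspace X \<rightarrow> carrier R"
    by (auto simp: char_fun_def)
  have "char_fun X R U ` topspace X \<subseteq> {\<zero>, \<one>}" by (auto simp: char_fun_def)
  then show "finite (char_fun X R U ` topspace X)" by (rule finite_subset) simp
  fix v
  \<comment> \<open>Written as a union of two conditional pieces so that it stays correct in the
    zero ring, where both conditions can hold at once.\<close>
  have "fibre X (char_fun X R U) v
      = (if v = \<one> then U else {}) \<union> (if v = \<zero> then topspace X - U else {})"
    using clopens_subset[OF assms] by (auto simp: fibre_def char_fun_def)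
  then show "openin X (fibre X (char_fun X R U) v)"
    using assms clopens_diff[OF assms] by (auto simp: clopens_def intro!: openin_Un)
qed

lemma const_map_closed:
  assumes "a \<in> carrier R"
  shows "const_map X a \<in> carrier (C_fin X R)"
proof -
  have "const_map X a ` topspace X \<subseteq> {a}" by (auto simp: const_map_def)
  then have "finite (const_map X a ` topspace X)" by (rule finite_subset) simp
  moreover have "fibre X (const_map X a) v = (if v = a then topspace X else {})" for v
    by (auto simp: fibre_def const_map_def)
  ultimately show ?thesis using assms by (simp add: C_fin_carrier_iff const_map_def)
qed

text \<open>The supremum runs over a finite set of norms because \<open>f\<close> has finite image,
  so it is a genuine upper bound.\<close>

lemma rnorm_le_C_fin:
  assumes "f \<in> carrier (C_fin X R)" and p: "p \<in> topspace X"
  shows "rnorm R (f p) \<le> rnorm (C_fin X R) f"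
proof -
  have "finite ((\<lambda>p. rnorm R (f p)) ` topspace X)"
    using C_fin_carrierD(2)[OF assms(1)] by (metis finite_imageI image_image)
  then have "rnorm R (f p) \<le> (SUP p\<in>topspace X. rnorm R (f p))"
    by (intro cSUP_upper p bdd_above_finite)
  then show ?thesis using p by (auto simp: C_fin_def)
qed

lemma rnorm_const_map:
  assumes "topspace X \<noteq> {}"
  shows "rnorm (C_fin X R) (const_map X a) = rnorm R a"
proof -
  have "(SUP p\<in>topspace X. rnorm R (const_map X a p)) = (SUP p\<in>topspace X. rnorm R a)"
    by (rule SUP_cong) (auto simp: const_map_def)
  also have "\<dots> = rnorm R a" using assms by (rule cSUP_const)
  finally show ?thesis using assms by (auto simp: C_fin_def)
qed

section \<open>The value of a function along a clopen ultrafilter\<close>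

text \<open>Existence: the finitely many fibres over attained values are clopen and cover the space,
  so primeness selects one of them.\<close>

lemma ultra_value_fibre:
  assumes F: "F \<in> clopen_ultrafilters X" and f: "f \<in> carrier (C_fin X R)"
  shows "fibre X f (ultra_value X F f) \<in> F"
proof -
  have "topspace X \<subseteq> (\<Union>v\<in>f ` topspace X. fibre X f v)" by (auto simp: fibre_def)
  then obtain v where "fibre X f v \<in> F"
    using clopen_ultrafilter_finite_cover[OF F C_fin_carrierD(2)[OF f], of "fibre X f"]
      C_fin_carrierD(4)[OF f] by metis
  then show ?thesis using ultra_value_eqI[OF F] by metis
qed

text \<open>Members of a proper filter are nonempty. Having an actual point with this value is what
  allows a comparison with the supremum norm.\<close>

lemma ultra_value_attained:
  assumes F: "F \<in> clopen_ultrafilters X" and f: "f \<in> carrier (C_fin X R)"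
  obtains p where "p \<in> topspace X" "f p = ultra_value X F f"
proof -
  have "fibre X f (ultra_value X F f) \<noteq> {}"
    using ultra_value_fibre[OF assms] F
    by (metis (mono_tags, lifting) clopen_ultrafilters_def mem_Collect_eq proper_clopen_filter_def)
  then show thesis using that by (auto simp: fibre_def)
qed

lemma ultra_value_closed:
  "F \<in> clopen_ultrafilters X \<Longrightarrow> f \<in> carrier (C_fin X R) \<Longrightarrow> ultra_value X F f \<in> carrier R"
  by (metis C_fin_carrierD(1) ultra_value_attained)

text \<open>On the intersection of the two selected fibres the combined function is constant. With
  \<open>h\<close> taken as multiplication or addition, \<open>ultra_value X F\<close> is seen to
  respect both ring operations.\<close>

lemma ultra_value_pointwise:
  assumes F: "F \<in> clopen_ultrafilters X"
    and f: "f \<in> carrier (C_fin X R)" and g: "g \<in> carrier (C_fin X R)"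
    and k: "(\<lambda>p\<in>topspace X. h (f p) (g p)) \<in> carrier (C_fin X R)"
  shows "ultra_value X F (\<lambda>p\<in>topspace X. h (f p) (g p))
    = h (ultra_value X F f) (ultra_value X F g)"
proof (rule ultra_value_eqI[OF F])
  let ?v = "ultra_value X F f" and ?w = "ultra_value X F g"
  let ?k = "\<lambda>p\<in>topspace X. h (f p) (g p)"
  have "fibre X f ?v \<inter> fibre X g ?w \<in> F"
    using ultra_value_fibre[OF F f] ultra_value_fibre[OF F g] F
    by (simp add: clopen_ultrafilters_def proper_clopen_filter_def)
  moreover have "fibre X f ?v \<inter> fibre X g ?w \<subseteq> fibre X ?k (h ?v ?w)"
    by (auto simp: fibre_def)
  ultimately show "fibre X ?k (h ?v ?w) \<in> F"
    using F C_fin_carrierD(4)[OF k] by (auto simp: clopen_ultrafilters_def proper_clopen_filter_def)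
qed

lemma ultra_value_const_map:
  assumes F: "F \<in> clopen_ultrafilters X"
  shows "ultra_value X F (const_map X a) = a"
proof (rule ultra_value_eqI[OF F])
  have "fibre X (const_map X a) a = topspace X" by (auto simp: fibre_def const_map_def)
  then show "fibre X (const_map X a) a \<in> F"
    using F by (simp add: clopen_ultrafilters_def proper_clopen_filter_def)
qed

lemma ultra_value_char_fun:
  assumes F: "F \<in> clopen_ultrafilters X" and U: "U \<in> clopens X"
  shows "ultra_value X F (char_fun X R U) = (if U \<in> F then \<one> else \<zero>)"
proof (rule ultra_value_eqI[OF F])
  define V where "V = (if U \<in> F then U else topspace X - U)"
  have "V \<in> F" using clopen_ultrafilter_dichotomy[OF F U] by (auto simp: V_def)
  \<comment> \<open>An inclusion only: in the zero ring the fibre is the whole space.\<close>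
  moreover have "V \<subseteq> fibre X (char_fun X R U) (if U \<in> F then \<one> else \<zero>)"
    using clopens_subset[OF U] by (auto simp: V_def fibre_def char_fun_def)
  ultimately show "fibre X (char_fun X R U) (if U \<in> F then \<one> else \<zero>) \<in> F"
    using F C_fin_carrierD(4)[OF char_fun_closed[OF U]]
    by (auto simp: clopen_ultrafilters_def proper_clopen_filter_def)
qed

section \<open>Gluing an ultrafilter and a seminorm on \<open>R\<close>\<close>

lemma glue_berkovich:
  assumes F: "F \<in> clopen_ultrafilters X" and y: "y \<in> berkovich_points R"
  shows "glue X R F y \<in> berkovich_points (C_fin X R)"
proof -
  let ?A = "C_fin X R"
  note yD = berkovich_pointsD[OF y]
  obtain C where C: "\<And>a. a \<in> carrier R \<Longrightarrow> y a \<le> C * rnorm R a" using yD(7) by blast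
  \<comment> \<open>The constant \<open>C\<close> may be negative, and \<open>\<bar>C\<bar>\<close>
    allows the inequality between \<open>rnorm R (f p)\<close> and the supremum norm to be
    multiplied by it.\<close>
  have bound: "glue X R F y f \<le> \<bar>C\<bar> * rnorm ?A f" if f: "f \<in> carrier ?A" for f
  proof -
    obtain p where p: "p \<in> topspace X" "f p = ultra_value X F f"
      using ultra_value_attained[OF F f] .
    have fp: "f p \<in> carrier R" using C_fin_carrierD(1)[OF f p(1)] .
    have "glue X R F y f = y (f p)" using f p(2) by (simp add: glue_def)
    also have "\<dots> \<le> C * rnorm R (f p)" using C fp .
    also have "\<dots> \<le> \<bar>C\<bar> * rnorm R (f p)" using rnorm_nonneg[OF fp] by (simp add: mult_right_mono)
    also have "\<dots> \<le> \<bar>C\<bar> * rnorm ?A f" using rnorm_le_C_fin[OF f p(1)] by (simp add: mult_left_mono)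
    finally show ?thesis .
  qed
  show ?thesis
    unfolding berkovich_points_def
  proof (intro CollectI conjI ballI)
    show "glue X R F y \<in> extensional (carrier ?A)" by (simp add: glue_def)
    show "0 \<le> glue X R F y f" if "f \<in> carrier ?A" for f
      using that yD(2) ultra_value_closed[OF F that] by (simp add: glue_def)
    show "glue X R F y \<zero>\<^bsub>?A\<^esub> = 0" "glue X R F y \<one>\<^bsub>?A\<^esub> = 1"
      using yD(3,4) by (simp_all add: glue_def const_map_closed ultra_value_const_map[OF F])
    show "glue X R F y (f \<otimes>\<^bsub>?A\<^esub> g) = glue X R F y f * glue X R F y g"
      if "f \<in> carrier ?A" "g \<in> carrier ?A" for f g
      using that yD(5) C_fin_mult_closed[OF that] ultra_value_closed[OF F]
        ultra_value_pointwise[OF F that, of "(\<otimes>)"]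
      by (simp add: glue_def)
    show "glue X R F y (f \<oplus>\<^bsub>?A\<^esub> g) \<le> glue X R F y f + glue X R F y g"
      if "f \<in> carrier ?A" "g \<in> carrier ?A" for f g
      using that yD(6) C_fin_add_closed[OF that] ultra_value_closed[OF F]
        ultra_value_pointwise[OF F that, of "(\<oplus>)"]
      by (simp add: glue_def)
    show "\<exists>C. \<forall>f\<in>carrier ?A. glue X R F y f \<le> C * rnorm ?A f" using bound by blast
  qed
qed

lemma point_filter_glue:
  assumes F: "F \<in> clopen_ultrafilters X" and y: "y \<in> berkovich_points R"
  shows "point_filter X R (glue X R F y) = F"
proof -
  \<comment> \<open>The value is \<open>y\<close> at \<open>1\<close> or at \<open>0\<close>, and
    these differ because \<open>y\<close> sends them to 1 and 0.\<close>
  have "glue X R F y (char_fun X R U) \<noteq> 0 \<longleftrightarrow> U \<in> F" if "U \<in> clopens X" for U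
    using berkovich_pointsD(3,4)[OF y] char_fun_closed[OF that] ultra_value_char_fun[OF F that]
    by (simp add: glue_def)
  moreover have "F \<subseteq> clopens X"
    using F by (simp add: clopen_ultrafilters_def proper_clopen_filter_def)
  ultimately show ?thesis by (auto simp: point_filter_def)
qed

lemma point_restrict_glue:
  assumes F: "F \<in> clopen_ultrafilters X" and y: "y \<in> berkovich_points R"
  shows "point_restrict X R (glue X R F y) = y"
proof (rule extensionalityI[of _ "carrier R"])
  show "y \<in> extensional (carrier R)" using berkovich_pointsD(1)[OF y] .
qed (simp_all add: point_restrict_def glue_def const_map_closed ultra_value_const_map[OF F])

section \<open>The ultrafilter and the restriction of a seminorm\<close>

lemma berkovich_char_fun_Int:
  assumes x: "x \<in> berkovich_points (C_fin X R)" and U: "U \<in> clopens X" and V: "V \<in> clopens X"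
  shows "x (char_fun X R (U \<inter> V)) = x (char_fun X R U) * x (char_fun X R V)"
proof -
  have "char_fun X R (U \<inter> V) = char_fun X R U \<otimes>\<^bsub>C_fin X R\<^esub> char_fun X R V"
    by (auto simp: char_fun_def fun_eq_iff)
  then show ?thesis using berkovich_pointsD(5)[OF x char_fun_closed[OF U] char_fun_closed[OF V]] by simp
qed

lemma berkovich_char_fun_empty:
  "x \<in> berkovich_points (C_fin X R) \<Longrightarrow> x (char_fun X R {}) = 0"
  using berkovich_pointsD(3)[of x "C_fin X R"] by (simp add: char_fun_def const_map_def)

lemma berkovich_char_fun_topspace:
  assumes "x \<in> berkovich_points (C_fin X R)"
  shows "x (char_fun X R (topspace X)) = 1"
proof -
  have "char_fun X R (topspace X) = const_map X \<one>" by (auto simp: char_fun_def const_map_def)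
  then show ?thesis using berkovich_pointsD(4)[OF assms] by simp
qed

text \<open>Idempotence of the characteristic function gives \<open>t = t * t\<close> for its value
  \<open>t\<close>, and \<open>t\<close> is nonzero by membership in the filter.\<close>

lemma berkovich_char_fun_eq_1:
  assumes "x \<in> berkovich_points (C_fin X R)" and "U \<in> point_filter X R x"
  shows "x (char_fun X R U) = 1"
  using assms berkovich_char_fun_Int[OF assms(1), of U U] by (simp add: point_filter_def)

text \<open>Multiplicativity of \<open>x\<close> on characteristic functions yields the filter
  axioms, and subadditivity yields the dichotomy that implies maximality.\<close>

lemma point_filter_ultrafilter:
  assumes x: "x \<in> berkovich_points (C_fin X R)"
  shows "point_filter X R x \<in> clopen_ultrafilters X"
proof (rule clopen_ultrafilterI)
  show "proper_clopen_filter X (point_filter X R x)"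
    unfolding proper_clopen_filter_def
  proof (intro conjI ballI impI)
    show "point_filter X R x \<subseteq> clopens X" by (auto simp: point_filter_def)
    show "topspace X \<in> point_filter X R x"
      using berkovich_char_fun_topspace[OF x] clopens_topspace by (simp add: point_filter_def)
    show "{} \<notin> point_filter X R x"
      using berkovich_char_fun_empty[OF x] by (simp add: point_filter_def)
    show "U \<inter> V \<in> point_filter X R x"
      if "U \<in> point_filter X R x" "V \<in> point_filter X R x" for U V
      using that berkovich_char_fun_Int[OF x, of U V] clopens_Int by (auto simp: point_filter_def)
    show "V \<in> point_filter X R x"
      if "U \<in> point_filter X R x" "V \<in> clopens X" "U \<subseteq> V" for U V
      \<comment> \<open>Since \<open>U \<inter> V = U\<close>, the nonzero value at \<open>U\<close>
        is a product with the value at \<open>V\<close> as a factor.\<close>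
      using that berkovich_char_fun_Int[OF x, of U V]
      by (auto simp: point_filter_def Int_absorb2)
  qed
  fix U assume U: "U \<in> clopens X"
  \<comment> \<open>The unit is the sum of the characteristic functions of \<open>U\<close> and its
    complement, so their values under \<open>x\<close> add up to at least 1 and cannot both
    vanish.\<close>
  note U' = clopens_diff[OF U]
  have "\<one>\<^bsub>C_fin X R\<^esub> = char_fun X R U \<oplus>\<^bsub>C_fin X R\<^esub> char_fun X R (topspace X - U)"
    by (auto simp: char_fun_def const_map_def fun_eq_iff)
  then have "1 \<le> x (char_fun X R U) + x (char_fun X R (topspace X - U))"
    using berkovich_pointsD(6)[OF x char_fun_closed[OF U] char_fun_closed[OF U']]
      berkovich_pointsD(4)[OF x] by simp
  then have "x (char_fun X R U) \<noteq> 0 \<or> x (char_fun X R (topspace X - U)) \<noteq> 0" by auto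
  then show "U \<in> point_filter X R x \<or> topspace X - U \<in> point_filter X R x"
    using U U' by (simp add: point_filter_def)
qed

lemma point_restrict_berkovich:
  assumes x: "x \<in> berkovich_points (C_fin X R)"
  shows "point_restrict X R x \<in> berkovich_points R"
proof -
  let ?A = "C_fin X R"
  note xD = berkovich_pointsD[OF x]
  \<comment> \<open>A point of the spectrum forces \<open>X\<close> to be nonempty. Only then does a
    constant function have the norm of its value, which carries the bound on \<open>x\<close> over
    to \<open>R\<close>.\<close>
  have "{} \<notin> point_filter X R x" "topspace X \<in> point_filter X R x"
    using point_filter_ultrafilter[OF x] by (auto simp: clopen_ultrafilters_def proper_clopen_filter_def)
  then have ne: "topspace X \<noteq> {}" by metis
  have const_mult: "const_map X (a \<otimes> b) = const_map X a \<otimes>\<^bsub>?A\<^esub> const_map X b" for a b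
    by (auto simp: const_map_def fun_eq_iff)
  have const_add: "const_map X (a \<oplus> b) = const_map X a \<oplus>\<^bsub>?A\<^esub> const_map X b" for a b
    by (auto simp: const_map_def fun_eq_iff)
  obtain C where C: "\<And>f. f \<in> carrier ?A \<Longrightarrow> x f \<le> C * rnorm ?A f" using xD(7) by blast
  show ?thesis
    unfolding berkovich_points_def
  proof (intro CollectI conjI ballI)
    show "point_restrict X R x \<in> extensional (carrier R)" by (simp add: point_restrict_def)
    show "0 \<le> point_restrict X R x a" if "a \<in> carrier R" for a
      using that xD(2)[OF const_map_closed[OF that]] by (simp add: point_restrict_def)
    show "point_restrict X R x \<zero> = 0" "point_restrict X R x \<one> = 1"
      using xD(3,4) by (simp_all add: point_restrict_def)
    show "point_restrict X R x (a \<otimes> b) = point_restrict X R x a * point_restrict X R x b"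
      if "a \<in> carrier R" "b \<in> carrier R" for a b
      using that xD(5)[OF const_map_closed const_map_closed, OF that]
      by (simp add: point_restrict_def const_mult del: C_fin_simps)
    show "point_restrict X R x (a \<oplus> b) \<le> point_restrict X R x a + point_restrict X R x b"
      if "a \<in> carrier R" "b \<in> carrier R" for a b
      using that xD(6)[OF const_map_closed const_map_closed, OF that]
      by (simp add: point_restrict_def const_add del: C_fin_simps)
    show "\<exists>C. \<forall>a\<in>carrier R. point_restrict X R x a \<le> C * rnorm R a"
      using C[OF const_map_closed] rnorm_const_map[OF ne]
      by (intro exI[of _ C]) (simp add: point_restrict_def)
  qed
qed

lemma glue_point:
  assumes x: "x \<in> berkovich_points (C_fin X R)"
  shows "glue X R (point_filter X R x) (point_restrict X R x) = x"
proof (rule extensionalityI[of _ "carrier (C_fin X R)"])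
  let ?A = "C_fin X R" and ?F = "point_filter X R x"
  note xD = berkovich_pointsD[OF x]
  note F = point_filter_ultrafilter[OF x]
  show "glue X R ?F (point_restrict X R x) \<in> extensional (carrier ?A)" by (simp add: glue_def)
  show "x \<in> extensional (carrier ?A)" by (rule xD(1))
  fix f assume f: "f \<in> carrier ?A"
  define v where "v = ultra_value X ?F f"
  \<comment> \<open>Multiplying by \<open>e\<close> turns \<open>f\<close> into the constant
    \<open>v\<close>: both products equal \<open>v\<close> on the fibre and vanish off it. As
    \<open>x e = 1\<close>, the factor cancels after applying \<open>x\<close>.\<close>
  define e where "e = char_fun X R (fibre X f v)"
  have v: "v \<in> carrier R" unfolding v_def by (rule ultra_value_closed[OF F f])
  have e: "e \<in> carrier ?A" "x e = 1"
    using ultra_value_fibre[OF F f] char_fun_closed[OF C_fin_carrierD(4)[OF f]]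
      berkovich_char_fun_eq_1[OF x] by (simp_all add: e_def v_def)
  have "f \<otimes>\<^bsub>?A\<^esub> e = const_map X v \<otimes>\<^bsub>?A\<^esub> e"
    using C_fin_carrierD(1)[OF f] v by (auto simp: e_def char_fun_def const_map_def fibre_def fun_eq_iff)
  then have "x f * x e = x (const_map X v) * x e"
    using xD(5)[OF f e(1)] xD(5)[OF const_map_closed[OF v] e(1)] by simp
  then show "glue X R ?F (point_restrict X R x) f = x f"
    using e(2) f v by (simp add: glue_def point_restrict_def v_def)
qed

section \<open>Continuity in both directions\<close>

lemma continuous_map_point_filter:
  "continuous_map (berkovich_spectrum (C_fin X R)) (banaschewski X) (point_filter X R)"
proof (rule continuous_map_banaschewskiI)
  show "point_filter X R \<in> topspace (berkovich_spectrum (C_fin X R)) \<rightarrow> clopen_ultrafilters X"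
    by (simp add: topspace_berkovich_spectrum point_filter_ultrafilter)
  fix U assume U: "U \<in> clopens X"
  \<comment> \<open>Membership of \<open>U\<close> in the filter of \<open>x\<close> says that
    evaluation at a fixed function lands in the open set of nonzero reals.\<close>
  have "openin (berkovich_spectrum (C_fin X R))
      {x \<in> topspace (berkovich_spectrum (C_fin X R)). x (char_fun X R U) \<in> - {0}}"
    by (rule openin_continuous_map_preimage[OF continuous_map_berkovich_eval[OF char_fun_closed[OF U]]])
      auto
  then show "openin (berkovich_spectrum (C_fin X R))
      {x \<in> topspace (berkovich_spectrum (C_fin X R)). U \<in> point_filter X R x}"
    using U by (simp add: point_filter_def)
qed

lemma continuous_map_point_restrict:
  "continuous_map (berkovich_spectrum (C_fin X R)) (berkovich_spectrum R) (point_restrict X R)"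
proof (rule continuous_map_berkovichI)
  show "point_restrict X R \<in> topspace (berkovich_spectrum (C_fin X R)) \<rightarrow> berkovich_points R"
    by (simp add: topspace_berkovich_spectrum point_restrict_berkovich)
  show "continuous_map (berkovich_spectrum (C_fin X R)) euclideanreal (\<lambda>x. point_restrict X R x a)"
    if "a \<in> carrier R" for a
    using that continuous_map_berkovich_eval[OF const_map_closed[OF that]]
    by (simp add: point_restrict_def)
qed

text \<open>By the topology of pointwise convergence it is enough to fix \<open>f\<close>. The
  ultrafilters containing a given fibre of \<open>f\<close> form a basic open set, and over it the
  map is evaluation of \<open>y\<close> at the fixed element \<open>v\<close>; these local pieces
  are pasted.\<close>

lemma continuous_map_glue:
  "continuous_map (prod_topology (banaschewski X) (berkovich_spectrum R))
     (berkovich_spectrum (C_fin X R)) (\<lambda>(F, y). glue X R F y)"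
  (is "continuous_map ?P _ _")
proof (rule continuous_map_berkovichI)
  have P: "topspace ?P = clopen_ultrafilters X \<times> berkovich_points R"
    by (simp add: topspace_banaschewski topspace_berkovich_spectrum)
  show "(\<lambda>(F, y). glue X R F y) \<in> topspace ?P \<rightarrow> berkovich_points (C_fin X R)"
    unfolding P using glue_berkovich by auto
  fix f assume f: "f \<in> carrier (C_fin X R)"
  define T where "T v = {F \<in> clopen_ultrafilters X. fibre X f v \<in> F} \<times> berkovich_points R" for v
  show "continuous_map ?P euclideanreal (\<lambda>z. (case z of (F, y) \<Rightarrow> glue X R F y) f)"
  proof (rule pasting_lemma[where I = "carrier R" and T = T and f = "\<lambda>v z. snd z v"])
    show "openin ?P (T v)" for v
      unfolding T_def openin_prod_Times_iff
      using openin_banaschewski_basic[OF C_fin_carrierD(4)[OF f]]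
        openin_topspace[of "berkovich_spectrum R"]
      by (simp add: topspace_berkovich_spectrum)
    show "continuous_map (subtopology ?P (T v)) euclideanreal (\<lambda>z. snd z v)"
      if "v \<in> carrier R" for v
      using continuous_map_compose[OF continuous_map_snd continuous_map_berkovich_eval[OF that]]
      by (intro continuous_map_from_subtopology) (simp add: o_def)
    \<comment> \<open>Two pieces with different \<open>v\<close> and \<open>w\<close> are disjoint,
      by uniqueness of the value along an ultrafilter.\<close>
    show "snd z v = snd z w" if "z \<in> topspace ?P \<inter> T v \<inter> T w" for v w z
    proof -
      have "fst z \<in> clopen_ultrafilters X" "fibre X f v \<in> fst z" "fibre X f w \<in> fst z"
        using that by (auto simp: T_def)
      then have "v = w" using ultra_value_eqI by metis
      then show ?thesis by simp
    qed
    fix z assume "z \<in> topspace ?P"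
    then obtain F y where z: "z = (F, y)" "F \<in> clopen_ultrafilters X" "y \<in> berkovich_points R"
      unfolding P by blast
    then show "\<exists>v. v \<in> carrier R \<and> z \<in> T v \<and> (case z of (F, y) \<Rightarrow> glue X R F y) f = snd z v"
      using ultra_value_closed[OF z(2) f] ultra_value_fibre[OF z(2) f] f
      by (intro exI[of _ "ultra_value X F f"]) (simp add: T_def glue_def)
  qed
qed

lemma homeomorphic_map_point:
  "homeomorphic_map (berkovich_spectrum (C_fin X R))
     (prod_topology (banaschewski X) (berkovich_spectrum R))
     (\<lambda>x. (point_filter X R x, point_restrict X R x))"
proof -
  have "homeomorphic_maps (berkovich_spectrum (C_fin X R))
      (prod_topology (banaschewski X) (berkovich_spectrum R))
      (\<lambda>x. (point_filter X R x, point_restrict X R x)) (\<lambda>(F, y). glue X R F y)"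
    unfolding homeomorphic_maps_def
    using continuous_map_pairedI[OF continuous_map_point_filter continuous_map_point_restrict]
      continuous_map_glue
    by (auto simp: topspace_banaschewski topspace_berkovich_spectrum
        glue_point point_filter_glue point_restrict_glue)
  then show ?thesis by (auto simp: homeomorphic_map_maps)
qed

end

theorem theorem3p10:
  fixes R :: "('a, 'm) normed_ring_scheme" and X :: "'x topology"
  assumes "banach_cring R \<or> nonarch_banach_cring R"
    and "isolated_at_zero R"
  shows "homeomorphic_map
           (berkovich_spectrum (C_fin X R))
           (prod_topology (banaschewski X) (berkovich_spectrum R))
           (\<lambda>x. (point_filter X R x, point_restrict X R x))"
proof -
  \<comment> \<open>Both alternatives give a commutative ring with a complete norm, so a single
    argument covers the two categories.\<close>
  have R: "cring R" "complete_norm R"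
    using assms(1)
    by (auto simp: banach_cring_def nonarch_banach_cring_def nonarch_banach_abelian_group_def
        banach_abelian_group_def)
  interpret cring R by fact
  interpret discrete_normed_cring R
  proof
    show "norm_topology R = discrete_topology (carrier R)"
      by (rule norm_topology_discrete[OF ring_axioms R(2) assms(2)])
    show "0 \<le> rnorm R a" if "a \<in> carrier R" for a
      using that R(2) by (simp add: complete_norm_def)
  qed
  show ?thesis by (rule homeomorphic_map_point)
qed

end
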